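(* Let $a>0$, $b\geq 0$, $c\geq 0$, $d\geq 0$ be real numbers. The following are equivalent: (i) The net $\left\{\frac{1}{a+bm+cn+dmn}\right\}_{m,n\in\mathbb{Z}_+}$ is completely monotone. (ii) The net $\left\{\frac{c+dm}{a+bm+cn+dmn}\right\}_{m,n\in\mathbb{Z}_+}$ is completely monotone. (iii) $ad-bc\leq 0$.
   Context: $\mathbb{Z}_+=\{0,1,2,\dots\}$, and $\mathbb{Z}_+^2$ is a semigroup under componentwise addition. For $e\in\mathbb{Z}_+^2$ and $g:\mathbb{Z}_+^2\to\mathbb{R}$, $(\nabla_e g)(s)=g(s)-g(s+e)$. A net $\phi:\mathbb{Z}_+^2\to\mathbb{R}$ is completely monotone if $\phi\geq 0$ and $\nabla_{e_1}\cdots\nabla_{e_r}\phi(s)\geq 0$ for all $r\geq 1$, all $e_1,\dots,e_r\in\mathbb{Z}_+^2$ (repetitions allowed) and all $s\in\mathbb{Z}_+^2$. *)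

theory Defs
  imports Complex_Main "HOL-Library.Product_Plus"
begin

definition nabla :: "nat \<times> nat \<Rightarrow> (nat \<times> nat \<Rightarrow> real) \<Rightarrow> nat \<times> nat \<Rightarrow> real" where
  "nabla e g = (\<lambda>s. g s - g (s + e))"

(* The list es = [e_1, ..., e_r] encodes the iterated difference:
   foldr nabla es \<phi> = nabla e_1 (... (nabla e_r \<phi>)). *)
definition completely_monotone_net :: "(nat \<times> nat \<Rightarrow> real) \<Rightarrow> bool" where
  "completely_monotone_net \<phi> \<longleftrightarrow>
     (\<forall>s. 0 \<le> \<phi> s) \<and> (\<forall>es s. length es \<ge> 1 \<longrightarrow> 0 \<le> foldr nabla es \<phi> s)"

end

theory Submission
  imports Defs "HOL-Analysis.Summation_Tests"
begin

text \<open>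
  Write D = a + bm + cn + dmn, \<open>\<phi>\<close> = 1/D, \<open>\<psi>\<close> = (c + dm)/D, \<open>\<chi>\<close> = (b + dn)/D and \<open>\<delta>\<close> = bc - ad. The
  differences of these three nets along the axes are products of translates of the same nets:
  along (e,0) they are e\<open>\<chi>\<phi>'\<close>, e\<open>\<delta>\<phi>\<phi>'\<close>, e\<open>\<chi>\<chi>'\<close>, and along (0,e) they are e\<open>\<psi>\<phi>'\<close>, e\<open>\<psi>\<psi>'\<close>,
  e\<open>\<delta>\<phi>\<phi>'\<close>, where a prime denotes translation by the step. If \<open>\<delta>\<close> is nonnegative, a simultaneous
  induction on the order of the differences shows that all three nets are completely monotone.
  Conversely, complete monotonicity of \<open>\<psi>\<close> forces \<open>\<delta>\<close> to be nonnegative already through its first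
  difference at the origin. For \<open>\<phi>\<close> with b > 0 one compares the differences of order k in m at the
  starting points of the rows n = 0 and n = 1: these are (1/q) k! / (p (p + 1) ... (p + k)) with
  p = a/b, q = b and p = (a + c)/(b + d), q = b + d respectively. If the second p were smaller,
  the divergence of the harmonic series would make the second row dominate the first for large k,
  so that a mixed difference would be negative. If b = 0, already the mixed difference of order
  two at the origin is negative unless d = 0.
\<close>

section \<open>Finite-order monotonicity and its closure properties\<close>

declare split_paired_All [simp del]

text \<open>Recursion on the order, rather than on lists of steps, lets one induction treat several
  nets at once. Nonnegativity at every level covers all differences of smaller order.\<close>

primrec monotone_upto :: "nat \<Rightarrow> (nat \<times> nat \<Rightarrow> real) \<Rightarrow> bool" where
  "monotone_upto 0 f \<longleftrightarrow> (\<forall>s. 0 \<le> f s)"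
| "monotone_upto (Suc r) f \<longleftrightarrow> (\<forall>s. 0 \<le> f s) \<and> (\<forall>e. monotone_upto r (nabla e f))"

lemma monotone_upto_nonneg: "monotone_upto r f \<Longrightarrow> 0 \<le> f s"
  by (cases r) auto

lemma monotone_upto_SucD: "monotone_upto (Suc r) f \<Longrightarrow> monotone_upto r f"
  by (induction r arbitrary: f) auto

lemma monotone_upto_foldr:
  "monotone_upto r f \<Longrightarrow> length es \<le> r \<Longrightarrow> 0 \<le> foldr nabla es f s"
proof (induction r arbitrary: f es)
  case (Suc r)
  then show ?case
    \<comment> \<open>\<open>foldr\<close> applies the last step of the list first, as the recursion
      does, so the list is split at its end.\<close>
    by (cases es rule: rev_cases) (auto simp: monotone_upto_nonneg)
qed (auto simp: monotone_upto_nonneg)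

lemma completely_monotone_netI:
  assumes "\<And>r. monotone_upto r f"
  shows "completely_monotone_net f"
  unfolding completely_monotone_net_def
  using assms monotone_upto_foldr monotone_upto_nonneg by blast

lemma nabla_apply: "nabla e f s = f s - f (s + e)"
  by (simp add: nabla_def)

lemma nabla_add: "nabla e (\<lambda>s. f s + g s) = (\<lambda>s. nabla e f s + nabla e g s)"
  by (auto simp: nabla_def)

lemma nabla_cmult: "nabla e (\<lambda>s. k * f s) = (\<lambda>s. k * nabla e f s)"
  by (auto simp: nabla_def algebra_simps)

lemma nabla_shift: "nabla e (\<lambda>s. f (s + u)) = (\<lambda>s. nabla e f (s + u))"
  by (auto simp: nabla_def add_ac)

lemma nabla_mult: "nabla e (\<lambda>s. f s * g s) = (\<lambda>s. f s * nabla e g s + nabla e f s * g (s + e))"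
  by (auto simp: nabla_def algebra_simps)

lemma nabla_plus: "nabla (e + u) f = (\<lambda>s. nabla e f s + nabla u f (s + e))"
  by (auto simp: nabla_def add_ac)

lemma monotone_upto_add:
  "monotone_upto r f \<Longrightarrow> monotone_upto r g \<Longrightarrow> monotone_upto r (\<lambda>s. f s + g s)"
  by (induction r arbitrary: f g) (auto simp: nabla_add)

lemma monotone_upto_cmult:
  "0 \<le> k \<Longrightarrow> monotone_upto r f \<Longrightarrow> monotone_upto r (\<lambda>s. k * f s)"
  by (induction r arbitrary: f) (auto simp: nabla_cmult)

lemma monotone_upto_shift: "monotone_upto r f \<Longrightarrow> monotone_upto r (\<lambda>s. f (s + u))"
  by (induction r arbitrary: f) (auto simp: nabla_shift)

text \<open>By the discrete Leibniz rule, the difference of a product is a sum of two products of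
  differences, factors and translates, to which the induction hypothesis applies.\<close>

lemma monotone_upto_mult:
  "monotone_upto r f \<Longrightarrow> monotone_upto r g \<Longrightarrow> monotone_upto r (\<lambda>s. f s * g s)"
proof (induction r arbitrary: f g)
  case (Suc r)
  have "monotone_upto r (nabla e (\<lambda>s. f s * g s))" for e
    unfolding nabla_mult
    using Suc.prems[THEN monotone_upto_SucD] Suc.prems
    by (intro monotone_upto_add Suc.IH monotone_upto_shift) simp_all
  then show ?case using Suc.prems by auto
qed auto

text \<open>A step \<open>(e, u)\<close> is a horizontal step followed by a vertical one, so its
  difference is the horizontal difference plus a translate of the vertical one.\<close>

lemma monotone_upto_Suc_axes:
  assumes "\<And>s. 0 \<le> f s"
    and "\<And>e. monotone_upto r (nabla (e, 0) f)"
    and "\<And>e. monotone_upto r (nabla (0, e) f)"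
  shows "monotone_upto (Suc r) f"
proof -
  have "monotone_upto r (nabla (e, u) f)" for e u
    using nabla_plus[of "(e, 0)" "(0, u)" f] assms(2)[of e] monotone_upto_shift[OF assms(3)[of u]]
    by (simp add: monotone_upto_add)
  then show ?thesis using assms(1) by auto
qed

section \<open>The three nets and their differences along the axes\<close>

lemma diff_divide_divide: "x \<noteq> 0 \<Longrightarrow> y \<noteq> 0 \<Longrightarrow> u / x - v / y = (u * y - v * x) / (x * (y::real))"
  by (simp add: field_simps)

context
  fixes a b c d :: real
begin

definition bilin :: "nat \<times> nat \<Rightarrow> real" where
  "bilin = (\<lambda>(m, n). a + b * real m + c * real n + d * real m * real n)"

definition rec_net :: "nat \<times> nat \<Rightarrow> real" where
  "rec_net = (\<lambda>s. 1 / bilin s)"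

definition row_net :: "nat \<times> nat \<Rightarrow> real" where
  "row_net = (\<lambda>s. (c + d * real (fst s)) / bilin s)"

definition col_net :: "nat \<times> nat \<Rightarrow> real" where
  "col_net = (\<lambda>s. (b + d * real (snd s)) / bilin s)"

context
  assumes pos: "a > 0" "b \<ge> 0" "c \<ge> 0" "d \<ge> 0"
begin

lemma bilin_pos: "bilin s > 0"
  using pos by (cases s) (simp add: bilin_def add_pos_nonneg)

lemma bilin_nz: "bilin s \<noteq> 0"
  using bilin_pos[of s] by simp

lemma bilin_step:
  "bilin (s + (e, 0)) = bilin s + real e * (b + d * real (snd s))"
  "bilin (s + (0, e)) = bilin s + real e * (c + d * real (fst s))"
  by (cases s; simp add: bilin_def algebra_simps)+

text \<open>These are numerators of differences over a common denominator. A step that changes the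
  numerator of the net leaves only the determinant \<open>b * c - a * d\<close>; a step that fixes
  it leaves the numerator times the increment of \<open>bilin\<close>.\<close>

lemma cross_differences:
  "(c + d * real (fst s)) * bilin (s + (e, 0)) - (c + d * real (fst (s + (e, 0)))) * bilin s =
    real e * (b * c - a * d)"
  "(c + d * real (fst s)) * bilin (s + (0, e)) - (c + d * real (fst (s + (0, e)))) * bilin s =
    real e * (c + d * real (fst s)) * (c + d * real (fst s))"
  "(b + d * real (snd s)) * bilin (s + (e, 0)) - (b + d * real (snd (s + (e, 0)))) * bilin s =
    real e * (b + d * real (snd s)) * (b + d * real (snd s))"
  "(b + d * real (snd s)) * bilin (s + (0, e)) - (b + d * real (snd (s + (0, e)))) * bilin s =
    real e * (b * c - a * d)"
  by (cases s, simp add: bilin_def, simp add: algebra_simps)+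

lemma nabla_divide_bilin:
  "nabla e (\<lambda>s. g s / bilin s) s =
    (g s * bilin (s + e) - g (s + e) * bilin s) / (bilin s * bilin (s + e))"
  by (simp add: nabla_def diff_divide_divide bilin_nz)

lemma nabla_rec_net:
  "nabla (e, 0) rec_net = (\<lambda>s. real e * (col_net s * rec_net (s + (e, 0))))"
  "nabla (0, e) rec_net = (\<lambda>s. real e * (row_net s * rec_net (s + (0, e))))"
  unfolding rec_net_def row_net_def col_net_def fun_eq_iff nabla_divide_bilin
  unfolding cross_differences by (simp_all add: bilin_step mult_ac)

lemma nabla_row_net:
  "nabla (e, 0) row_net = (\<lambda>s. (real e * (b * c - a * d)) * (rec_net s * rec_net (s + (e, 0))))"
  "nabla (0, e) row_net = (\<lambda>s. real e * (row_net s * row_net (s + (0, e))))"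
  unfolding rec_net_def row_net_def col_net_def fun_eq_iff nabla_divide_bilin
  unfolding cross_differences by (simp_all add: bilin_step mult_ac)

lemma nabla_col_net:
  "nabla (e, 0) col_net = (\<lambda>s. real e * (col_net s * col_net (s + (e, 0))))"
  "nabla (0, e) col_net = (\<lambda>s. (real e * (b * c - a * d)) * (rec_net s * rec_net (s + (0, e))))"
  unfolding rec_net_def row_net_def col_net_def fun_eq_iff nabla_divide_bilin
  unfolding cross_differences by (simp_all add: bilin_step mult_ac)

lemma nets_nonneg: "0 \<le> rec_net s" "0 \<le> row_net s" "0 \<le> col_net s"
  using pos bilin_pos[of s] by (auto simp: rec_net_def row_net_def col_net_def)

lemma monotone_upto_nets:
  assumes "a * d - b * c \<le> 0"
  shows "monotone_upto r rec_net \<and> monotone_upto r row_net \<and> monotone_upto r col_net"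
proof (induction r)
  case (Suc r)
  then show ?case
    using assms
    by (intro conjI monotone_upto_Suc_axes;
      simp add: nabla_rec_net nabla_row_net nabla_col_net nets_nonneg
        monotone_upto_cmult monotone_upto_mult monotone_upto_shift)
qed (auto simp: nets_nonneg)

lemma completely_monotone_nets:
  assumes "a * d - b * c \<le> 0"
  shows "completely_monotone_net rec_net" "completely_monotone_net row_net"
  by (rule completely_monotone_netI, simp add: monotone_upto_nets[OF assms])+

lemma row_net_completely_monotoneD:
  assumes "completely_monotone_net row_net"
  shows "a * d - b * c \<le> 0"
proof -
  have "0 \<le> foldr nabla [(1, 0)] row_net (0, 0)"
    using assms unfolding completely_monotone_net_def
    by (metis One_nat_def le_refl length_Cons list.size(3))
  then have "0 \<le> (b * c - a * d) * (rec_net (0, 0) * rec_net (1, 0))"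
    by (simp add: nabla_row_net)
  moreover have "0 < rec_net (0, 0) * rec_net (1, 0)"
    using bilin_pos by (simp add: rec_net_def)
  ultimately show ?thesis
    by (simp add: zero_le_mult_iff)
qed

end

end

section \<open>Iterated differences of reciprocals and growth of Pochhammer ratios\<close>

lemma foldr_nabla_diff:
  "foldr nabla es (\<lambda>s. f s - g s) s = foldr nabla es f s - foldr nabla es g s"
  by (induction es arbitrary: s) (auto simp: nabla_def)

lemma foldr_nabla_inverse_linear:
  fixes p q :: real
  assumes "p > 0" "q > 0"
  shows "foldr nabla (replicate k (1, 0)) (\<lambda>(m, n). 1 / (q * (p + real m))) (m, n) =
    fact k / (q * pochhammer (p + real m) (Suc k))"
proof (induction k arbitrary: m)
  case (Suc k)
  define x where "x = p + real m"
  have x: "x > 0" using assms by (simp add: x_def)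
  define P where "P = pochhammer (x + 1) k"
  have P: "P > 0" using x by (simp add: P_def pochhammer_pos)
  have 1: "pochhammer x (Suc k) = x * P"
    by (simp add: P_def pochhammer_rec)
  have 2: "pochhammer (x + 1) (Suc k) = P * (x + 1 + real k)"
    by (simp add: P_def pochhammer_Suc)
  have 3: "pochhammer x (Suc (Suc k)) = x * P * (x + 1 + real k)"
    by (simp add: 2 pochhammer_rec[of x "Suc k"])
  have "foldr nabla (replicate (Suc k) (1, 0)) f (m, n) =
      foldr nabla (replicate k (1, 0)) f (m, n) - foldr nabla (replicate k (1, 0)) f (Suc m, n)"
    for f by (simp add: nabla_apply del: foldr_replicate)
  then have "foldr nabla (replicate (Suc k) (1, 0)) (\<lambda>(m, n). 1 / (q * (p + real m))) (m, n) =
    fact k / (q * pochhammer x (Suc k)) - fact k / (q * pochhammer (p + real (Suc m)) (Suc k))"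
    by (simp only: Suc x_def)
  also have "p + real (Suc m) = x + 1"
    by (simp add: x_def)
  also have "fact k / (q * pochhammer x (Suc k)) - fact k / (q * pochhammer (x + 1) (Suc k)) =
    fact k / (q * (x * P)) - fact k / (q * (P * (x + 1 + real k)))"
    by (simp only: 1 2)
  also have "\<dots> = fact (Suc k) / (q * (x * P * (x + 1 + real k)))"
  proof -
    \<comment> \<open>The two fractions share the factor \<open>P\<close>; their difference
      contributes \<open>y - x = k + 1\<close>, the new factor of the factorial.\<close>
    define y where "y = x + 1 + real k"
    have "y > 0" "fact (Suc k) = fact k * (y - x)" using x by (simp_all add: y_def)
    then show ?thesis unfolding y_def[symmetric]
      using assms x P by (simp add: field_simps)
  qed
  finally show ?case
    using 3 by (simp add: x_def)
qed (use assms in simp)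

lemma sum_le_prod_one_plus:
  fixes f :: "nat \<Rightarrow> real"
  assumes "\<And>j. 0 \<le> f j"
  shows "1 + (\<Sum>j<k. f j) \<le> (\<Prod>j<k. 1 + f j)"
proof (induction k)
  case (Suc k)
  have "0 \<le> (\<Sum>j<k. f j)" using assms by (simp add: sum_nonneg)
  then have "f k * 1 \<le> f k * (\<Prod>j<k. 1 + f j)"
    using assms[of k] Suc by (intro mult_left_mono) auto
  then show ?case using Suc by (simp add: algebra_simps)
qed simp

text \<open>The ratio is the product of the factors \<open>1 + (p - q) / (q + j)\<close>, which
  exceeds the sum of the \<open>(p - q) / (q + j)\<close>. A bound on it would make the harmonic
  series converge.\<close>

lemma pochhammer_ratio_unbounded:
  fixes p q C :: real
  assumes "0 < q" "q < p"
  shows "\<exists>k. pochhammer p (Suc k) > C * pochhammer q (Suc k)"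
proof (rule ccontr)
  assume "\<not> ?thesis"
  then have le: "pochhammer p (Suc k) \<le> C * pochhammer q (Suc k)" for k
    by (simp add: not_less)
  define f where "f j = (p - q) / (q + real j)" for j
  have f0: "0 \<le> f j" for j using assms by (simp add: f_def)
  have "(\<Sum>j<k. f j) \<le> C" for k
  proof -
    have "(\<Sum>j<k. f j) \<le> (\<Sum>j<Suc k. f j)" using f0 by simp
    also have "\<dots> \<le> (\<Prod>j<Suc k. 1 + f j)"
      using sum_le_prod_one_plus[of f "Suc k", OF f0] by linarith
    also have "\<dots> = (\<Prod>j<Suc k. (p + real j) / (q + real j))"
      using assms by (intro prod.cong) (auto simp: f_def field_simps)
    also have "\<dots> = pochhammer p (Suc k) / pochhammer q (Suc k)"
      by (simp only: prod_dividef pochhammer_prod atLeast0LessThan)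
    also have "\<dots> \<le> C"
      using le[of k] pochhammer_pos[of q "Suc k"] assms by (simp add: pos_divide_le_eq)
    finally show ?thesis .
  qed
  then have sf: "summable f"
    using f0 by (intro summableI_nonneg_bounded) auto
  obtain N where N: "q \<le> real N" using real_arch_simple by blast
  have "summable (\<lambda>j. f j / (p - q))" using sf by (rule summable_divide)
  then have "summable (\<lambda>j. inverse (real (j + N)))"
  proof (rule summable_comparison_test[rotated], intro exI allI impI)
    fix j
    show "norm (inverse (real (j + N))) \<le> f j / (p - q)"
    proof -
      have "f j / (p - q) = inverse (q + real j)"
        using assms by (simp add: f_def inverse_eq_divide)
      moreover have "inverse (real (j + N)) \<le> inverse (q + real j)"
        using assms N by (intro le_imp_inverse_le) auto
      ultimately show ?thesis by simp
    qed
  qed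
  then show False
    using not_summable_harmonic[where 'a = real] summable_iff_shift[of "\<lambda>j. inverse (real j)" N]
    by simp
qed

section \<open>Necessity of the sign condition for the reciprocal net\<close>

lemma rec_net_completely_monotoneD:
  fixes a b c d :: real
  assumes pos: "a > 0" "b \<ge> 0" "c \<ge> 0" "d \<ge> 0"
    and cm: "completely_monotone_net
      (\<lambda>(m, n). 1 / (a + b * real m + c * real n + d * real m * real n))"
      (is "completely_monotone_net ?f")
  shows "a * d - b * c \<le> 0"
proof (rule ccontr)
  assume "\<not> ?thesis"
  then have gt: "b * c < a * d" by simp
  then have d: "d > 0" using pos
    by (metis less_eq_real_def mult_nonneg_nonneg mult_zero_right not_less)
  have nonneg: "0 \<le> foldr nabla (replicate k (1, 0) @ [(0, 1)]) ?f (0, 0)" for k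
    using cm unfolding completely_monotone_net_def
    by (elim conjE allE[of _ "replicate k (1, 0) @ [(0, 1)]"]) simp
  show False
  proof (cases "b = 0")
    case True
    \<comment> \<open>With \<open>b = 0\<close> the mixed difference at the origin is
      \<open>1/a - 1/a - 1/(a + c) + 1/(a + c + d)\<close>.\<close>
    have "1 / (a + c + d) < 1 / (a + c)"
      using pos d by (intro divide_strict_left_mono) auto
    then show False
      using nonneg[of 1] True by (simp add: nabla_def)
  next
    case False
    then have b: "b > 0" using pos by simp
    \<comment> \<open>The denominators on the rows n = 0 and n = 1 are \<open>b * (p + m)\<close>
      and \<open>(b + d) * (p' + m)\<close>, and \<open>p' < p\<close> amounts to
      \<open>b * c < a * d\<close>.\<close>
    define p p' where "p = a / b" and "p' = (a + c) / (b + d)"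
    have p: "0 < p'" "p' < p"
      using gt b pos d by (auto simp: p_def p'_def field_simps add_pos_nonneg)
    have rows: "nabla (0, 1) ?f (m, 0) =
        1 / (b * (p + real m)) - 1 / ((b + d) * (p' + real m))" for m
    proof -
      have "b * (p + real m) = a + b * real m" using b by (simp add: p_def field_simps)
      moreover have "(b + d) * p' = a + c" using b d by (simp add: p'_def)
      then have "(b + d) * (p' + real m) = a + b * real m + c + d * real m"
        by (simp only: distrib_left) (simp add: distrib_right)
      ultimately show ?thesis by (simp add: nabla_apply)
    qed
    \<comment> \<open>Horizontal differences on the row n = 0 see only that row, so the formula in
      \<open>rows\<close>, valid only there, may replace the net.\<close>
    have row0: "foldr nabla (replicate k (1, 0)) f (m, 0) = foldr nabla (replicate k (1, 0)) g (m, 0)"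
      if "\<And>m. f (m, 0) = g (m, 0)" for k m and f g :: "nat \<times> nat \<Rightarrow> real"
      using that by (induction k arbitrary: m) (auto simp: nabla_def)
    have le: "fact k / ((b + d) * pochhammer p' (Suc k)) \<le> fact k / (b * pochhammer p (Suc k))" for k
    proof -
      have "foldr nabla (replicate k (1, 0)) (nabla (0, 1) ?f) (0, 0) =
        foldr nabla (replicate k (1, 0)) (\<lambda>s. (\<lambda>(m, n). 1 / (b * (p + real m))) s -
          (\<lambda>(m, n). 1 / ((b + d) * (p' + real m))) s) (0, 0)"
        by (rule row0) (simp only: rows prod.case)
      also have "\<dots> = fact k / (b * pochhammer p (Suc k)) - fact k / ((b + d) * pochhammer p' (Suc k))"
        using foldr_nabla_inverse_linear[of p b k 0 0] foldr_nabla_inverse_linear[of p' "b + d" k 0 0]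
          b d p by (simp only: foldr_nabla_diff) simp
      finally show ?thesis using nonneg[of k] by simp
    qed
    \<comment> \<open>The constant \<open>(b + d) / b\<close> compensates for the different leading
      factors of the two rows.\<close>
    obtain k where k: "pochhammer p (Suc k) > (b + d) / b * pochhammer p' (Suc k)"
      using pochhammer_ratio_unbounded[OF p] by blast
    then have "(b + d) * pochhammer p' (Suc k) < b * pochhammer p (Suc k)"
      using b by (simp add: field_simps)
    moreover have "0 < (b + d) * pochhammer p' (Suc k)"
      using b d pochhammer_pos[OF p(1), of "Suc k"] by simp
    ultimately have "fact k / (b * pochhammer p (Suc k)) < fact k / ((b + d) * pochhammer p' (Suc k))"
      by (intro divide_strict_left_mono) (auto intro: mult_pos_pos)
    then show False using le[of k] by simp
  qed
qed

theorem corollary3p10: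
  fixes a b c d :: real
  assumes "a > 0" and "b \<ge> 0" and "c \<ge> 0" and "d \<ge> 0"
  shows "(completely_monotone_net
            (\<lambda>(m, n). 1 / (a + b * real m + c * real n + d * real m * real n)) \<longleftrightarrow>
          completely_monotone_net
            (\<lambda>(m, n). (c + d * real m) / (a + b * real m + c * real n + d * real m * real n))) \<and>
         (completely_monotone_net
            (\<lambda>(m, n). (c + d * real m) / (a + b * real m + c * real n + d * real m * real n)) \<longleftrightarrow>
          a * d - b * c \<le> 0)"
proof -
  have rec: "rec_net a b c d = (\<lambda>(m, n). 1 / (a + b * real m + c * real n + d * real m * real n))"
    by (auto simp: rec_net_def bilin_def)
  have row: "row_net a b c d =
      (\<lambda>(m, n). (c + d * real m) / (a + b * real m + c * real n + d * real m * real n))"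
    by (auto simp: row_net_def bilin_def)
  show ?thesis
    using completely_monotone_nets[OF assms] row_net_completely_monotoneD[OF assms]
      rec_net_completely_monotoneD[OF assms]
    unfolding rec row by blast
qed

end
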